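(* There exist absolute constants $c_1,c_2$ such that the following holds. For all integers $1<k\le n$ and every $\varepsilon>0$ there exists a prefix $(2^k,\varepsilon)$-extractor $E\colon\{0,1\}^n\times\{0,1\}^d\to\{0,1\}^m$ with $d=\log n+2\log(1/\varepsilon)+c_1$ and $m=k+d-2\log(1/\varepsilon)-c_2$.
   Context: A bipartite graph (multiple edges allowed) with left part of size $N$, right part of size $M$, and all left vertices of degree $D$ is a $(K,\varepsilon)$-extractor if for every subset $S$ of the left part with $\#S\ge K$ and every subset $Y$ of the right part, $\left|\frac{\#E(S,Y)}{D\cdot\#S}-\frac{\#Y}{M}\right|<\varepsilon$, where $E(S,Y)$ is the set (counted with multiplicity) of edges between $S$ and $Y$. With $N=2^n$, $D=2^d$, $M=2^m$, such a graph is identified with a function $E\colon\{0,1\}^n\times\{0,1\}^d\to\{0,1\}^m$ mapping a left vertex and the index of one of its edges to the corresponding right vertex. A $(2^k,\varepsilon)$-extractor $E\colon\{0,1\}^n\times\{0,1\}^d\to\{0,1\}^m$ is a prefix extractor if for every $i\le k$ the function $E_i\colon\{0,1\}^n\times\{0,1\}^d\to\{0,1\}^{m-i}$ obtained by deleting the last $i$ bits of the output of $E$ is a $(2^{k-i},\varepsilon)$-extractor. Logarithms are base 2; the parameters are assumed to be such that $d,m$ are integers. *)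

theory Defs
  imports Complex_Main "HOL-Library.FuncSet"
begin

definition bitstrings :: "nat \<Rightarrow> bool list set" where
  "bitstrings n = {x. length x = n}"

text \<open>
  A bipartite multigraph with left part \<open>L\<close> and right part \<open>R\<close>, in which the edges leaving
  each left vertex are indexed by \<open>I\<close>, is given by a function \<open>E\<close> on \<open>L \<times> I\<close>: the pair
  \<open>(x, j)\<close> is the \<open>j\<close>-th edge at \<open>x\<close> and \<open>E (x, j)\<close> is its right endpoint. Counting the
  pairs \<open>(x, j)\<close> therefore counts edges with multiplicity.
\<close>

definition edges_between ::
    "'i set \<Rightarrow> ('l \<times> 'i \<Rightarrow> 'r) \<Rightarrow> 'l set \<Rightarrow> 'r set \<Rightarrow> ('l \<times> 'i) set" where
  "edges_between I E S Y = {e \<in> S \<times> I. E e \<in> Y}"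

definition graph_extractor ::
    "'l set \<Rightarrow> 'i set \<Rightarrow> 'r set \<Rightarrow> nat \<Rightarrow> real \<Rightarrow> ('l \<times> 'i \<Rightarrow> 'r) \<Rightarrow> bool" where
  "graph_extractor L I R K \<epsilon> E \<longleftrightarrow>
     E \<in> L \<times> I \<rightarrow> R \<and>
     (\<forall>S Y. S \<subseteq> L \<longrightarrow> K \<le> card S \<longrightarrow> Y \<subseteq> R \<longrightarrow>
        \<bar>real (card (edges_between I E S Y)) / (real (card I) * real (card S))
           - real (card Y) / real (card R)\<bar> < \<epsilon>)"

definition extractor ::
    "nat \<Rightarrow> nat \<Rightarrow> nat \<Rightarrow> nat \<Rightarrow> real \<Rightarrow> (bool list \<times> bool list \<Rightarrow> bool list) \<Rightarrow> bool" where
  "extractor n d m K \<epsilon> E \<longleftrightarrow>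
     graph_extractor (bitstrings n) (bitstrings d) (bitstrings m) K \<epsilon> E"

text \<open>
  Deleting the last \<open>i\<close> of \<open>m\<close> bits is \<open>take (m - i)\<close>. For \<open>i > m\<close> this deletes everything, and
  the condition on \<open>\<lambda>e. take (m - i) (E e)\<close> then holds trivially (the right part is a single
  vertex).
\<close>

definition prefix_extractor ::
    "nat \<Rightarrow> nat \<Rightarrow> nat \<Rightarrow> nat \<Rightarrow> real \<Rightarrow> (bool list \<times> bool list \<Rightarrow> bool list) \<Rightarrow> bool" where
  "prefix_extractor n d m k \<epsilon> E \<longleftrightarrow>
     extractor n d m (2 ^ k) \<epsilon> E \<and>
     (\<forall>i\<le>k. extractor n d (m - i) (2 ^ (k - i)) \<epsilon> (\<lambda>e. take (m - i) (E e)))"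

end

theory Submission imports Defs begin

text \<open>
  The map \<open>E\<close> is chosen uniformly at random. For a fixed truncation \<open>i\<close>, a set \<open>S\<close> of left vertices and
  a set \<open>Y\<close> of right vertices, the exponential moment method bounds the probability that \<open>S\<close> and
  \<open>Y\<close> violate the extractor condition by \<open>2 exp (- \<epsilon>\<^sup>2 D |S| / 4)\<close>. The choice of \<open>m\<close> makes the number
  of sets \<open>Y\<close> at most \<open>exp (\<epsilon>\<^sup>2 D |S| / 8)\<close> simultaneously for all \<open>i\<close>, because truncation divides both
  \<open>2\<^sup>m\<close> and the lower bound on \<open>|S|\<close> by \<open>2\<^sup>i\<close>. The choice of \<open>d\<close> makes the remaining factor
  \<open>exp (- \<epsilon>\<^sup>2 D |S| / 8)\<close> at most \<open>exp (- 8 n |S|)\<close>, which is summable over all \<open>S\<close> and \<open>i\<close>.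
\<close>

section \<open>Exponential moments and the union bound for a random function\<close>

text \<open>For negative \<open>x\<close>, the product of \<open>1 + x + x\<^sup>2\<close> and
  \<open>1 - x\<close> is \<open>1 - x ^ 3\<close>, which is at least 1, and \<open>1 - x\<close> is
  at most \<open>exp (- x)\<close>.\<close>

lemma exp_le_quadratic:
  fixes x :: real
  assumes "\<bar>x\<bar> \<le> 1"
  shows "exp x \<le> 1 + x + x\<^sup>2"
proof (cases "0 \<le> x")
  case True
  then show ?thesis using assms by (intro exp_bound) auto
next
  case False
  have "1 \<le> 1 - x ^ 3"
    using False by (simp add: power3_eq_cube mult_nonneg_nonpos zero_le_mult_iff mult_le_0_iff)
  also have "\<dots> = (1 + x + x\<^sup>2) * (1 - x)"
    by (simp add: algebra_simps power2_eq_square power3_eq_cube)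
  also have "\<dots> \<le> (1 + x + x\<^sup>2) * exp (- x)"
    using exp_ge_add_one_self[of "- x"] assms by (intro mult_left_mono) auto
  finally show ?thesis by (simp add: exp_minus field_simps)
qed

text \<open>The left side is the moment generating function of a centred Bernoulli variable. In the
  quadratic bound for \<open>exp\<close> the linear terms cancel, and the variance
  \<open>p * (1 - p)\<close> is at most 1. Hoeffding's constant 1/8 in the exponent is given up for
  a shorter proof.\<close>

lemma bernoulli_mgf_le:
  fixes p t :: real
  assumes p: "0 \<le> p" "p \<le> 1" and t: "\<bar>t\<bar> \<le> 1"
  shows "p * exp (t * (1 - p)) + (1 - p) * exp (- (t * p)) \<le> exp (t\<^sup>2)"
proof -
  have "\<bar>t * (1 - p)\<bar> \<le> 1 * 1" "\<bar>- (t * p)\<bar> \<le> 1 * 1"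
    unfolding abs_mult abs_minus_cancel using p t by (intro mult_mono; simp)+
  then have "p * exp (t * (1 - p)) + (1 - p) * exp (- (t * p))
      \<le> p * (1 + t * (1 - p) + (t * (1 - p))\<^sup>2) + (1 - p) * (1 + (- (t * p)) + (- (t * p))\<^sup>2)"
    using p by (intro add_mono mult_left_mono exp_le_quadratic) auto
  also have "\<dots> = 1 + t\<^sup>2 * (p * (1 - p))"
    by (simp add: algebra_simps power2_eq_square)
  also have "\<dots> \<le> 1 + t\<^sup>2 * (1 * 1)"
    using p by (intro add_left_mono mult_left_mono mult_mono) auto
  also have "\<dots> \<le> exp (t\<^sup>2)" using exp_ge_add_one_self[of "t\<^sup>2"] by simp
  finally show ?thesis .
qed

lemma sum_exp_indicator_le:
  fixes t :: real
  assumes R: "finite R" "R \<noteq> {}" and Z: "Z \<subseteq> R" and t: "\<bar>t\<bar> \<le> 1"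
  shows "(\<Sum>r\<in>R. exp (t * (of_bool (r \<in> Z) - card Z / card R))) \<le> card R * exp (t\<^sup>2)"
proof -
  define p where "p = card Z / real (card R)"
  have R0: "real (card R) > 0" using R by (simp add: card_gt_0_iff)
  have ZR: "card Z \<le> card R" using R Z by (simp add: card_mono)
  have p: "0 \<le> p" "p \<le> 1" unfolding p_def using R0 ZR by auto
  have "(\<Sum>r\<in>R. exp (t * (of_bool (r \<in> Z) - p)))
      = (\<Sum>r\<in>R - Z. exp (- (t * p))) + (\<Sum>r\<in>Z. exp (t * (1 - p)))"
    using R Z by (subst sum.subset_diff[of Z R]) (auto intro!: sum.cong)
  also have "\<dots> = (real (card R) - card Z) * exp (- (t * p)) + card Z * exp (t * (1 - p))"
    using R Z ZR by (simp add: card_Diff_subset finite_subset of_nat_diff)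
  also have "\<dots> = card R * (p * exp (t * (1 - p)) + (1 - p) * exp (- (t * p)))"
    unfolding p_def using R0 by (simp add: field_simps)
  also have "\<dots> \<le> card R * exp (t\<^sup>2)"
    using bernoulli_mgf_le[OF p t] by (intro mult_left_mono) auto
  finally show ?thesis unfolding p_def .
qed

text \<open>The values of a uniformly random \<open>f\<close> are independent, so the unnormalised
  expectation factors over the points of \<open>T\<close>. A point of \<open>U\<close> gives the
  moment of a centred indicator, with success probability the density of \<open>Z\<close> in
  \<open>R\<close>; any other point gives just \<open>card R\<close>.\<close>

lemma sum_PiE_exp_deviation_le:
  fixes t :: real
  assumes T: "finite T" and U: "U \<subseteq> T" and R: "finite R" "R \<noteq> {}" and Z: "Z \<subseteq> R"
    and t: "\<bar>t\<bar> \<le> 1"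
  shows "(\<Sum>f\<in>T \<rightarrow>\<^sub>E R. exp (t * (card {e \<in> U. f e \<in> Z} - card U * (card Z / card R))))
    \<le> card (T \<rightarrow>\<^sub>E R) * exp (card U * t\<^sup>2)"
proof -
  define p where "p = card Z / real (card R)"
  define g where "g = (\<lambda>e r. if e \<in> U then exp (t * (of_bool (r \<in> Z) - p)) else 1)"
  have fU: "finite U" using T U finite_subset by blast
  have eq: "exp (t * (card {e \<in> U. f e \<in> Z} - card U * p)) = (\<Prod>e\<in>T. g e (f e))" for f
  proof -
    have "(\<Prod>e\<in>T. g e (f e)) = (\<Prod>e\<in>U. exp (t * (of_bool (f e \<in> Z) - p)))"
      unfolding g_def using T U by (simp add: prod.If_cases Int_absorb1)
    also have "\<dots> = exp (\<Sum>e\<in>U. t * (of_bool (f e \<in> Z) - p))"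
      using fU by (simp add: exp_sum)
    also have "(\<Sum>e\<in>U. t * (of_bool (f e \<in> Z) - p)) = t * (card {e \<in> U. f e \<in> Z} - card U * p)"
      using fU by (simp add: sum_distrib_left[symmetric] sum_subtractf of_bool_def sum.If_cases
          Int_def)
    finally show ?thesis by simp
  qed
  have "(\<Sum>f\<in>T \<rightarrow>\<^sub>E R. exp (t * (card {e \<in> U. f e \<in> Z} - card U * p)))
      = (\<Prod>e\<in>T. \<Sum>r\<in>R. g e r)"
    using T R by (simp add: eq prod_sum_PiE)
  also have "\<dots> \<le> (\<Prod>e\<in>T. card R * (if e \<in> U then exp (t\<^sup>2) else 1))"
    using sum_exp_indicator_le[OF R Z t] unfolding g_def p_def
    by (intro prod_mono) (auto intro: sum_nonneg)
  also have "\<dots> = card (T \<rightarrow>\<^sub>E R) * exp (card U * t\<^sup>2)"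
    using T U by (simp add: prod.distrib prod.If_cases Int_absorb1 card_PiE exp_of_nat_mult)
  finally show ?thesis unfolding p_def .
qed

text \<open>Union bound: the sum of the exponential moments, normalised so that every violated constraint
  contributes at least 1, is less than 1 on average, hence less than 1 for some \<open>f\<close>.\<close>

lemma exists_function_small_deviations:
  fixes \<epsilon> :: real and U :: "'a \<Rightarrow> 'e set" and Z :: "'a \<Rightarrow> 'r set"
  assumes T: "finite T" and R: "finite R" "R \<noteq> {}" and A: "finite A"
    and U: "\<And>a. a \<in> A \<Longrightarrow> U a \<subseteq> T" and Z: "\<And>a. a \<in> A \<Longrightarrow> Z a \<subseteq> R"
    and eps: "0 < \<epsilon>" "\<epsilon> \<le> 1"
    and small: "(\<Sum>a\<in>A. 2 * exp (- (\<epsilon>\<^sup>2 * card (U a) / 4))) < 1"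
  shows "\<exists>f \<in> T \<rightarrow>\<^sub>E R. \<forall>a\<in>A.
    \<bar>card {e \<in> U a. f e \<in> Z a} - card (U a) * (card (Z a) / card R)\<bar> < \<epsilon> * card (U a)"
proof (rule ccontr)
  assume neg: "\<not> ?thesis"
  \<comment> \<open>With \<open>u = card (U a)\<close>, this value minimises the exponent
    \<open>- t * \<epsilon> * u + t\<^sup>2 * u\<close>; the minimum is
    \<open>- \<epsilon>\<^sup>2 * u / 4\<close>. The bound \<open>\<epsilon> \<le> 1\<close> keeps
    \<open>t\<close> within the range of the moment estimate.\<close>
  define t where "t = \<epsilon> / 2"
  define X where "X f a = card {e \<in> U a. f e \<in> Z a} - card (U a) * (card (Z a) / real (card R))"
    for f a
  define G where "G f a = exp (- (t * (\<epsilon> * card (U a)))) * (exp (t * X f a) + exp ((- t) * X f a))"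
    for f a
  have t: "0 < t" "\<bar>t\<bar> \<le> 1" "\<bar>- t\<bar> \<le> 1" using eps by (auto simp: t_def)
  have fin: "finite (T \<rightarrow>\<^sub>E R)" using T R by (intro finite_PiE) auto
  have pos: "real (card (T \<rightarrow>\<^sub>E R)) > 0"
    using fin R by (simp add: card_gt_0_iff PiE_eq_empty_iff)
  have Gpos: "0 \<le> G f a" for f a unfolding G_def by (intro mult_nonneg_nonneg add_nonneg_nonneg) auto
  have ge1: "1 \<le> (\<Sum>a\<in>A. G f a)" if f: "f \<in> T \<rightarrow>\<^sub>E R" for f
  proof -
    obtain a where a: "a \<in> A" and dev: "\<epsilon> * card (U a) \<le> \<bar>X f a\<bar>"
      using neg f unfolding X_def by (meson not_less)
    have "exp (t * (\<epsilon> * card (U a))) \<le> exp (t * \<bar>X f a\<bar>)"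
      using dev t by simp
    \<comment> \<open>Using both signs of \<open>t\<close> covers deviations upwards and downwards;
      this is the source of the factor 2 in \<open>small\<close>.\<close>
    also have "\<dots> \<le> exp (t * X f a) + exp ((- t) * X f a)"
      by (cases "0 \<le> X f a") (auto simp: abs_if add_increasing add_increasing2)
    finally have "exp (- (t * (\<epsilon> * card (U a)))) * exp (t * (\<epsilon> * card (U a))) \<le> G f a"
      unfolding G_def by (intro mult_left_mono) auto
    then have "1 \<le> G f a" by (simp add: exp_minus)
    also have "\<dots> \<le> (\<Sum>a\<in>A. G f a)" using a A Gpos by (intro member_le_sum) auto
    finally show ?thesis .
  qed
  have mean: "(\<Sum>f\<in>T \<rightarrow>\<^sub>E R. G f a) \<le> card (T \<rightarrow>\<^sub>E R) * (2 * exp (- (\<epsilon>\<^sup>2 * card (U a) / 4)))"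
    if a: "a \<in> A" for a
  proof -
    let ?c = "exp (- (t * (\<epsilon> * card (U a))))" and ?q = "real (card (T \<rightarrow>\<^sub>E R)) * exp (card (U a) * t\<^sup>2)"
    have "(\<Sum>f\<in>T \<rightarrow>\<^sub>E R. G f a)
        = ?c * ((\<Sum>f\<in>T \<rightarrow>\<^sub>E R. exp (t * X f a)) + (\<Sum>f\<in>T \<rightarrow>\<^sub>E R. exp ((- t) * X f a)))"
      unfolding G_def sum_distrib_left[symmetric] sum.distrib ..
    also have "\<dots> \<le> ?c * (?q + ?q)"
      using sum_PiE_exp_deviation_le[OF T U[OF a] R Z[OF a] t(2)]
        sum_PiE_exp_deviation_le[OF T U[OF a] R Z[OF a] t(3)]
      unfolding X_def by (intro mult_left_mono add_mono) auto
    also have "\<dots> = card (T \<rightarrow>\<^sub>E R) * (2 * (?c * exp (card (U a) * t\<^sup>2)))" by simp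
    also have "?c * exp (card (U a) * t\<^sup>2) = exp (- (\<epsilon>\<^sup>2 * card (U a) / 4))"
      unfolding exp_add[symmetric] t_def by (simp add: power2_eq_square field_simps)
    finally show ?thesis .
  qed
  have "real (card (T \<rightarrow>\<^sub>E R)) = (\<Sum>f\<in>T \<rightarrow>\<^sub>E R. 1)" by simp
  also have "\<dots> \<le> (\<Sum>f\<in>T \<rightarrow>\<^sub>E R. \<Sum>a\<in>A. G f a)" by (intro sum_mono ge1)
  also have "\<dots> = (\<Sum>a\<in>A. \<Sum>f\<in>T \<rightarrow>\<^sub>E R. G f a)" by (rule sum.swap)
  also have "\<dots> \<le> (\<Sum>a\<in>A. card (T \<rightarrow>\<^sub>E R) * (2 * exp (- (\<epsilon>\<^sup>2 * card (U a) / 4))))"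
    by (intro sum_mono mean)
  also have "\<dots> = card (T \<rightarrow>\<^sub>E R) * (\<Sum>a\<in>A. 2 * exp (- (\<epsilon>\<^sup>2 * card (U a) / 4)))"
    by (rule sum_distrib_left[symmetric])
  also have "\<dots> < real (card (T \<rightarrow>\<^sub>E R)) * 1"
    using small pos by (rule mult_strict_left_mono)
  finally show False by simp
qed

text \<open>Over all subsets the sum is \<open>(1 + w) ^ card L\<close>, by expanding the product.
  This is at most \<open>exp (card L * w)\<close>, hence at most
  \<open>1 + 2 * (card L * w)\<close>, and the empty set accounts for the 1.\<close>

lemma sum_nonempty_subsets_power_le:
  fixes w :: real
  assumes L: "finite L" and w: "0 \<le> w" "card L * w \<le> 1"
  shows "(\<Sum>S\<in>Pow L - {{}}. w ^ card S) \<le> 2 * (card L * w)"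
proof -
  have "(\<Sum>S\<in>Pow L. w ^ card S) = (1 + w) ^ card L"
    using prod_add[OF L, of "\<lambda>_. w" "\<lambda>_. 1"] by (simp add: add.commute)
  also have "\<dots> \<le> exp w ^ card L"
    using exp_ge_add_one_self[of w] w by (intro power_mono) auto
  also have "\<dots> = exp (card L * w)" by (simp add: exp_of_nat_mult)
  also have "\<dots> \<le> 1 + card L * w + (card L * w)\<^sup>2"
    using w by (intro exp_bound) auto
  also have "(card L * w)\<^sup>2 \<le> card L * w"
    using w mult_left_mono[of "card L * w" 1 "card L * w"] by (simp add: power2_eq_square)
  finally have "(\<Sum>S\<in>Pow L. w ^ card S) \<le> 1 + 2 * (card L * w)" by (simp add: mult.commute)
  moreover have "(\<Sum>S\<in>Pow L. w ^ card S) = 1 + (\<Sum>S\<in>Pow L - {{}}. w ^ card S)"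
    using L by (subst sum.remove[of _ "{}"]) auto
  ultimately show ?thesis by simp
qed

section \<open>Bit strings, degenerate cases and truncation\<close>

lemma finite_bitstrings [simp]: "finite (bitstrings n)"
  and card_bitstrings [simp]: "card (bitstrings n) = 2 ^ n"
  using finite_lists_length_eq[of "UNIV :: bool set" n]
    card_lists_length_eq[of "UNIV :: bool set" n]
  by (simp_all add: bitstrings_def)

lemma bitstrings_nonempty [simp]: "bitstrings n \<noteq> {}"
  unfolding bitstrings_def by (simp add: Ex_list_of_length)

text \<open>Splitting a string after position \<open>j\<close> is a bijection. Consequently a set of
  truncated strings and its preimage under truncation have the same density.\<close>

lemma card_bitstrings_with_prefix:
  assumes Y: "Y \<subseteq> bitstrings j" and "j \<le> m"
  shows "card {r \<in> bitstrings m. take j r \<in> Y} = card Y * 2 ^ (m - j)"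
proof -
  have "bij_betw (\<lambda>(a, b). a @ b) (Y \<times> bitstrings (m - j)) {r \<in> bitstrings m. take j r \<in> Y}"
  proof (rule bij_betwI[where g = "\<lambda>r. (take j r, drop j r)"])
  qed (use assms in \<open>auto simp: bitstrings_def subset_iff\<close>)
  then show ?thesis
    by (simp add: bij_betw_same_card[symmetric] card_cartesian_product)
qed

text \<open>Both ratios lie between 0 and 1, and they coincide when \<open>Y\<close> is empty or all
  of \<open>R\<close>. For any other \<open>Y\<close> the second ratio is strictly between 0 and 1,
  so the difference is strictly below 1.\<close>

lemma graph_extractor_if_card_right_eq_1_or_eps_ge_1:
  assumes fin: "finite L" "finite I" "I \<noteq> {}" "finite R" and E: "E \<in> L \<times> I \<rightarrow> R"
    and K: "0 < K" and eps: "0 < \<epsilon>" "card R = 1 \<or> 1 \<le> \<epsilon>"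
  shows "graph_extractor L I R K \<epsilon> E"
  unfolding graph_extractor_def
proof (intro conjI allI impI E)
  fix S Y assume S: "S \<subseteq> L" "K \<le> card S" and Y: "Y \<subseteq> R"
  define a where "a = real (card (edges_between I E S Y)) / (real (card I) * real (card S))"
  define b where "b = real (card Y) / real (card R)"
  have fS: "finite S" "S \<noteq> {}" using S fin K finite_subset by auto
  have pos: "0 < card I * card S" using fS fin by (simp add: card_gt_0_iff)
  have R0: "R \<noteq> {}" using E fS S fin by (auto simp: Pi_iff)
  have "card (edges_between I E S Y) \<le> card (S \<times> I)"
    unfolding edges_between_def using fS fin by (intro card_mono) auto
  also have "card (S \<times> I) = card I * card S" by (simp add: card_cartesian_product)
  finally have "real (card (edges_between I E S Y)) \<le> real (card I * card S)" by (simp only: of_nat_le_iff)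
  then have a: "0 \<le> a" "a \<le> 1" unfolding a_def using pos by (auto simp: divide_le_eq)
  have "\<bar>a - b\<bar> < \<epsilon>"
  proof (cases "Y = {} \<or> Y = R")
    case True
    have "b = a" if "Y = R"
    proof -
      have "edges_between I E S Y = S \<times> I"
        unfolding edges_between_def using that E S by (auto simp: Pi_iff)
      then show ?thesis
        unfolding a_def b_def using that pos R0 fin by (simp add: card_cartesian_product)
    qed
    moreover have "b = a" if "Y = {}"
      unfolding a_def b_def edges_between_def using that by simp
    ultimately show ?thesis using True eps by auto
  next
    case False
    then have Y': "0 < card Y" "card Y < card R"
      using Y fin finite_subset psubset_card_mono[of R Y] by (auto simp: card_gt_0_iff)
    \<comment> \<open>A nonempty proper subset excludes \<open>card R = 1\<close>, which leaves
      \<open>1 \<le> \<epsilon>\<close>.\<close>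
    then have "0 < b" "b < 1" "1 \<le> \<epsilon>" unfolding b_def using eps by auto
    then show ?thesis using a by auto
  qed
  then show "\<bar>real (card (edges_between I E S Y)) / (real (card I) * real (card S))
      - real (card Y) / real (card R)\<bar> < \<epsilon>" unfolding a_def b_def .
qed

lemma graph_extractor_cong:
  assumes "\<And>e. e \<in> L \<times> I \<Longrightarrow> E e = E' e"
  shows "graph_extractor L I R K \<epsilon> E \<longleftrightarrow> graph_extractor L I R K \<epsilon> E'"
proof -
  have "edges_between I E S Y = edges_between I E' S Y" if "S \<subseteq> L" for S Y
    unfolding edges_between_def using assms that by auto
  moreover have "E \<in> L \<times> I \<rightarrow> R \<longleftrightarrow> E' \<in> L \<times> I \<rightarrow> R"
    using assms by (auto simp: Pi_iff)
  ultimately show ?thesis unfolding graph_extractor_def by auto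
qed

text \<open>For \<open>i > m\<close> the natural subtraction \<open>m - i\<close> is 0 and the empty
  string is the only right vertex. The condition on \<open>E\<close> itself is the case
  \<open>i = 0\<close>, since \<open>take m\<close> fixes every output of length
  \<open>m\<close>.\<close>

lemma prefix_extractorI:
  assumes E: "E \<in> bitstrings n \<times> bitstrings d \<rightarrow> bitstrings m" and eps: "0 < \<epsilon>"
    and ext: "\<And>i. i \<le> k \<Longrightarrow> i \<le> m \<Longrightarrow> extractor n d (m - i) (2 ^ (k - i)) \<epsilon> (\<lambda>e. take (m - i) (E e))"
  shows "prefix_extractor n d m k \<epsilon> E"
proof -
  have "extractor n d (m - i) (2 ^ (k - i)) \<epsilon> (\<lambda>e. take (m - i) (E e))" if "i \<le> k" for i
  proof (cases "i \<le> m")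
    case True
    then show ?thesis using ext that by blast
  next
    case False
    then show ?thesis
      unfolding extractor_def using eps
      by (intro graph_extractor_if_card_right_eq_1_or_eps_ge_1) (auto simp: bitstrings_def[of 0])
  qed
  moreover have "graph_extractor (bitstrings n) (bitstrings d) (bitstrings m) K \<epsilon> (\<lambda>e. take m (E e))
      \<longleftrightarrow> graph_extractor (bitstrings n) (bitstrings d) (bitstrings m) K \<epsilon> E" for K
    using E by (intro graph_extractor_cong) (auto simp: Pi_iff bitstrings_def)
  ultimately show ?thesis
    unfolding prefix_extractor_def extractor_def by (metis diff_zero le0)
qed

text \<open>Pulling \<open>Y\<close> back along \<open>take j\<close> changes neither the edges
  counted nor the density. All truncations thus become constraints on the single map
  \<open>E\<close>, with deviations scaled by the number of edges leaving \<open>S\<close>.\<close>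

lemma extractor_take_if_small_deviations:
  fixes \<epsilon> :: real
  assumes E: "E \<in> bitstrings n \<times> bitstrings d \<rightarrow> bitstrings m" and j: "j \<le> m" and K: "0 < K"
    and dev: "\<And>S Y. S \<subseteq> bitstrings n \<Longrightarrow> K \<le> card S \<Longrightarrow> Y \<subseteq> bitstrings j \<Longrightarrow>
      \<bar>card {e \<in> S \<times> bitstrings d. E e \<in> {r \<in> bitstrings m. take j r \<in> Y}}
        - card (S \<times> bitstrings d) * (card {r \<in> bitstrings m. take j r \<in> Y} / card (bitstrings m))\<bar>
      < \<epsilon> * card (S \<times> bitstrings d)"
  shows "extractor n d j K \<epsilon> (\<lambda>e. take j (E e))"
  unfolding extractor_def graph_extractor_def
proof (intro conjI allI impI)
  show "(\<lambda>e. take j (E e)) \<in> bitstrings n \<times> bitstrings d \<rightarrow> bitstrings j"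
    using E j by (auto simp: Pi_iff bitstrings_def)
next
  fix S Y assume S: "S \<subseteq> bitstrings n" "K \<le> card S" and Y: "Y \<subseteq> bitstrings j"
  define u where "u = real (card (bitstrings d)) * real (card S)"
  define c where "c = real (card (edges_between (bitstrings d) (\<lambda>e. take j (E e)) S Y))"
  define b where "b = real (card Y) / real (card (bitstrings j))"
  have u: "0 < u" unfolding u_def using S K by auto
  have "edges_between (bitstrings d) (\<lambda>e. take j (E e)) S Y
      = {e \<in> S \<times> bitstrings d. E e \<in> {r \<in> bitstrings m. take j r \<in> Y}}"
    unfolding edges_between_def using E S by (auto simp: Pi_iff)
  moreover have "card {r \<in> bitstrings m. take j r \<in> Y} / real (card (bitstrings m)) = b"
    unfolding b_def card_bitstrings_with_prefix[OF Y j]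
    using j by (simp add: field_simps flip: power_add)
  ultimately have "\<bar>c - u * b\<bar> < \<epsilon> * u"
    using dev[OF S Y] unfolding u_def c_def by (simp add: card_cartesian_product mult.commute)
  also have "\<bar>c - u * b\<bar> = \<bar>c / u - b\<bar> * u"
    using u by (simp add: field_simps flip: abs_mult_pos')
  finally show "\<bar>real (card (edges_between (bitstrings d) (\<lambda>e. take j (E e)) S Y))
      / (real (card (bitstrings d)) * real (card S)) - real (card Y) / real (card (bitstrings j))\<bar> < \<epsilon>"
    using u unfolding u_def c_def b_def by (simp only: mult_less_cancel_right_pos)
qed

section \<open>The union bound over truncations and vertex sets\<close>

text \<open>The factor \<open>n + 1\<close> bounds the number of truncations, and the rest bounds
  the sum over left vertex sets. Each of \<open>n + 1\<close>, 4 and \<open>2 ^ n\<close> is at most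
  \<open>exp n\<close>, which leaves \<open>exp (- 5 n)\<close>.\<close>

lemma union_bound_lt_1:
  fixes n :: nat
  assumes "2 \<le> n"
  shows "(real n + 1) * (4 * (2 ^ n * exp (- (8 * real n)))) < 1"
proof -
  have "(real n + 1) * 4 \<le> exp (real n) * exp (real n)"
  proof (rule mult_mono)
    show "real n + 1 \<le> exp (real n)" using exp_ge_add_one_self[of "real n"] by linarith
    have "(4::real) = 2 ^ 2" by simp
    also have "\<dots> \<le> exp 1 ^ 2" using exp_ge_add_one_self[of 1] by (intro power_mono) auto
    also have "\<dots> = exp 2" by (simp flip: exp_of_nat_mult)
    also have "\<dots> \<le> exp (real n)" using assms by simp
    finally show "4 \<le> exp (real n)" .
  qed auto
  moreover have "(2::real) ^ n \<le> exp (real n)"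
    using exp_ge_add_one_self[of 1] power_mono[of 2 "exp 1 :: real" n] by (simp flip: exp_of_nat_mult)
  ultimately have "((real n + 1) * 4) * (2 ^ n * exp (- (8 * real n)))
      \<le> (exp (real n) * exp (real n)) * (exp (real n) * exp (- (8 * real n)))"
    by (rule mult_mono[OF _ mult_right_mono]) auto
  also have "\<dots> = exp (- (5 * real n))" by (simp flip: exp_add)
  also have "\<dots> < 1" using assms by simp
  finally show ?thesis by (simp only: mult.assoc)
qed

lemma exists_prefix_extractor:
  fixes \<epsilon> :: real
  assumes k: "k \<le> n" and n: "2 \<le> n" and eps: "0 < \<epsilon>" "\<epsilon> \<le> 1"
    and D: "64 * real n \<le> 2 ^ d * \<epsilon>\<^sup>2" and M: "8 * 2 ^ m \<le> 2 ^ k * (2 ^ d * \<epsilon>\<^sup>2)"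
  shows "\<exists>E. prefix_extractor n d m k \<epsilon> E"
proof -
  define \<delta> where "\<delta> = 2 ^ d * \<epsilon>\<^sup>2"
  define \<S> where "\<S> i = {S. S \<subseteq> bitstrings n \<and> 2 ^ (k - i) \<le> card S}" for i
  \<comment> \<open>One constraint per truncation \<open>i\<close>, admissible \<open>S\<close> and
    set \<open>Y\<close> of truncated strings. \<open>U\<close> collects the edges leaving
    \<open>S\<close>, and \<open>Z\<close> is the preimage of \<open>Y\<close> among the full
    strings.\<close>
  define A where "A = (SIGMA i:{..min k m}. \<S> i \<times> Pow (bitstrings (m - i)))"
  define U where "U = (\<lambda>(i::nat, S, Y::bool list set). S \<times> bitstrings d :: (bool list \<times> bool list) set)"
  define Z where "Z = (\<lambda>(i, S::bool list set, Y). {r \<in> bitstrings m. take (m - i) r \<in> Y})"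
  define w where "w = exp (- (8 * real n))"
  have finS: "finite (\<S> i)" for i
    unfolding \<S>_def by (rule finite_subset[of _ "Pow (bitstrings n)"]) auto
  have finA: "finite A" unfolding A_def using finS by (intro finite_SigmaI) auto
  have UT: "U a \<subseteq> bitstrings n \<times> bitstrings d" and ZR: "Z a \<subseteq> bitstrings m" if "a \<in> A" for a
    using that unfolding A_def U_def Z_def \<S>_def by auto
  have term_le: "(\<Sum>Y\<in>Pow (bitstrings (m - i)). 2 * exp (- (\<epsilon>\<^sup>2 * card (U (i, S, Y)) / 4)))
      \<le> 2 * w ^ card S" if i: "i \<le> min k m" and S: "S \<in> \<S> i" for i S
  proof -
    have Sc: "(2::real) ^ (k - i) \<le> card S"
      using S unfolding \<S>_def by (metis (mono_tags) mem_Collect_eq numeral_power_le_of_nat_cancel_iff)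
    have "2 ^ i * (8 * (2::real) ^ (m - i)) = 8 * 2 ^ m"
      using i by (simp flip: power_add)
    also have "\<dots> \<le> 2 ^ k * \<delta>" using M unfolding \<delta>_def .
    also have "\<dots> = 2 ^ i * (2 ^ (k - i) * \<delta>)"
      using i by (simp flip: power_add mult.assoc)
    finally have "8 * (2::real) ^ (m - i) \<le> 2 ^ (k - i) * \<delta>" by simp
    also have "\<dots> \<le> card S * \<delta>"
      using Sc unfolding \<delta>_def by (intro mult_right_mono) auto
    finally have Y: "real (2 ^ (m - i)) \<le> card S * \<delta> / 8" by simp
    have "(2::real) ^ (2 ^ (m - i)) \<le> exp 1 ^ (2 ^ (m - i))"
      using exp_ge_add_one_self[of 1] by (intro power_mono) auto
    also have "\<dots> = exp (real (2 ^ (m - i)))" by (simp flip: exp_of_nat_mult)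
    also have "\<dots> \<le> exp (card S * \<delta> / 8)" using Y by (simp only: exp_le_cancel_iff)
    finally have num: "(2::real) ^ (2 ^ (m - i)) \<le> exp (card S * \<delta> / 8)" .
    have "(\<Sum>Y\<in>Pow (bitstrings (m - i)). 2 * exp (- (\<epsilon>\<^sup>2 * card (U (i, S, Y)) / 4)))
        = 2 * (2 ^ (2 ^ (m - i)) * exp (- (card S * \<delta> / 4)))"
      unfolding U_def \<delta>_def by (simp add: card_cartesian_product card_Pow ac_simps)
    \<comment> \<open>Half of the exponent \<open>card S * \<delta> / 4\<close> pays for the choice
      of \<open>Y\<close>; by \<open>D\<close> the remaining half is at least
      \<open>8 * n * card S\<close>.\<close>
    also have "\<dots> \<le> 2 * (exp (card S * \<delta> / 8) * exp (- (card S * \<delta> / 4)))"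
      using num by (intro mult_left_mono mult_right_mono) auto
    also have "\<dots> = 2 * exp (- (card S * (\<delta> / 8)))"
      by (simp flip: exp_add)
    also have "\<dots> \<le> 2 * exp (- (card S * (8 * real n)))"
      using D mult_left_mono[OF D, of "card S"] unfolding \<delta>_def by simp
    also have "\<dots> = 2 * w ^ card S"
      unfolding w_def by (simp flip: exp_of_nat_mult)
    finally show ?thesis .
  qed
  have final: "(real n + 1) * (4 * (2 ^ n * w)) < 1"
    unfolding w_def by (rule union_bound_lt_1[OF n])
  \<comment> \<open>The final estimate also yields \<open>2 ^ n * w \<le> 1\<close>, the condition
    for summing over subsets.\<close>
  have "2 ^ n * w \<le> (real n + 1) * (4 * (2 ^ n * w))"
    using mult_right_mono[of 1 "(real n + 1) * 4" "2 ^ n * w"] unfolding w_def by (simp add: mult.assoc)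
  with final have Nw: "real (card (bitstrings n)) * w \<le> 1"
    unfolding card_bitstrings of_nat_power of_nat_numeral by linarith
  have sum_S: "(\<Sum>S\<in>\<S> i. 2 * w ^ card S) \<le> 4 * (2 ^ n * w)" for i
  proof -
    \<comment> \<open>The lower bound \<open>2 ^ (k - i)\<close> on \<open>card S\<close> is
      positive, so the empty set is excluded.\<close>
    have "(\<Sum>S\<in>\<S> i. w ^ card S) \<le> (\<Sum>S\<in>Pow (bitstrings n) - {{}}. w ^ card S)"
      unfolding \<S>_def w_def by (intro sum_mono2) auto
    also have "\<dots> \<le> 2 * (card (bitstrings n) * w)"
      using Nw by (intro sum_nonempty_subsets_power_le) (auto simp: w_def)
    finally show ?thesis by (simp add: mult.commute flip: sum_distrib_left)
  qed
  have "(\<Sum>a\<in>A. 2 * exp (- (\<epsilon>\<^sup>2 * card (U a) / 4)))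
      = (\<Sum>i\<le>min k m. \<Sum>S\<in>\<S> i. \<Sum>Y\<in>Pow (bitstrings (m - i)). 2 * exp (- (\<epsilon>\<^sup>2 * card (U (i, S, Y)) / 4)))"
    unfolding A_def using finS by (simp add: sum.Sigma sum.cartesian_product case_prod_unfold)
  also have "\<dots> \<le> (\<Sum>i\<le>min k m. \<Sum>S\<in>\<S> i. 2 * w ^ card S)"
    using term_le by (intro sum_mono) auto
  also have "\<dots> \<le> (\<Sum>i\<le>min k m. 4 * (2 ^ n * w))" by (intro sum_mono sum_S)
  also have "\<dots> = (real (min k m) + 1) * (4 * (2 ^ n * w))" by simp
  also have "\<dots> \<le> (real n + 1) * (4 * (2 ^ n * w))"
    using k unfolding w_def by (intro mult_right_mono) auto
  finally have "(\<Sum>a\<in>A. 2 * exp (- (\<epsilon>\<^sup>2 * card (U a) / 4))) < 1" using final by simp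
  from exists_function_small_deviations[where U = U and Z = Z, OF
      finite_SigmaI[OF finite_bitstrings finite_bitstrings] finite_bitstrings bitstrings_nonempty
      finA UT ZR eps this]
  obtain E where E: "E \<in> bitstrings n \<times> bitstrings d \<rightarrow>\<^sub>E bitstrings m"
    and dev: "\<And>a. a \<in> A \<Longrightarrow> \<bar>card {e \<in> U a. E e \<in> Z a}
      - card (U a) * (card (Z a) / card (bitstrings m))\<bar> < \<epsilon> * card (U a)"
    by blast
  have E': "E \<in> bitstrings n \<times> bitstrings d \<rightarrow> bitstrings m" using E by auto
  have "prefix_extractor n d m k \<epsilon> E"
  proof (rule prefix_extractorI[OF E' eps(1)])
    fix i assume i: "i \<le> k" "i \<le> m"
    show "extractor n d (m - i) (2 ^ (k - i)) \<epsilon> (\<lambda>e. take (m - i) (E e))"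
    proof (rule extractor_take_if_small_deviations[OF E'], goal_cases)
      case (3 S Y)
      then have "(i, S, Y) \<in> A" unfolding A_def \<S>_def using i by auto
      from dev[OF this] show ?case unfolding U_def Z_def by simp
    qed auto
  qed
  then show ?thesis by blast
qed

section \<open>Substituting the logarithmic parameters\<close>

lemma two_powr_log_inverse_square:
  fixes \<epsilon> :: real
  assumes "0 < \<epsilon>"
  shows "2 powr (2 * log 2 (1 / \<epsilon>)) = 1 / \<epsilon>\<^sup>2"
proof -
  have "2 powr (2 * log 2 (1 / \<epsilon>)) = (2 powr log 2 (1 / \<epsilon>)) powr 2"
    by (simp add: powr_powr mult.commute)
  also have "\<dots> = 1 / \<epsilon>\<^sup>2" using assms by (simp add: power_divide)
  finally show ?thesis .
qed

theorem theorem5: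
  shows "\<exists>c1 c2 :: int. \<forall>(n::nat) (k::nat) (\<epsilon>::real) (d::nat) (m::nat).
    1 < k \<longrightarrow> k \<le> n \<longrightarrow> 0 < \<epsilon> \<longrightarrow>
    int d = \<lceil>log 2 (real n) + 2 * log 2 (1 / \<epsilon>) + real_of_int c1\<rceil> \<longrightarrow>
    int m = \<lfloor>real k + real d - 2 * log 2 (1 / \<epsilon>) - real_of_int c2\<rfloor> \<longrightarrow>
    (\<exists>E. prefix_extractor n d m k \<epsilon> E)"
\<comment> \<open>The witnesses come from \<open>2 ^ 6 = 64\<close> and \<open>2 ^ 3 = 8\<close>,
  the constants in the bounds \<open>D\<close> and \<open>M\<close>.\<close>
proof (rule exI[of _ 6], rule exI[of _ 3], intro allI impI)
  fix n k d m :: nat and \<epsilon> :: real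
  assume k: "1 < k" "k \<le> n" and eps: "0 < \<epsilon>"
    and d: "int d = \<lceil>log 2 (real n) + 2 * log 2 (1 / \<epsilon>) + real_of_int 6\<rceil>"
    and m: "int m = \<lfloor>real k + real d - 2 * log 2 (1 / \<epsilon>) - real_of_int 3\<rfloor>"
  show "\<exists>E. prefix_extractor n d m k \<epsilon> E"
  proof (cases "\<epsilon> \<le> 1")
    case True
    \<comment> \<open>Rounding \<open>d\<close> up and \<open>m\<close> down preserves the two
      inequalities in the directions required; \<open>m\<close> is computed from the already rounded
      \<open>d\<close>.\<close>
    have d': "log 2 (real n) + 2 * log 2 (1 / \<epsilon>) + 6 \<le> real d"
      using d by linarith
    have m': "real m \<le> real k + real d - 2 * log 2 (1 / \<epsilon>) - 3"
      using m by linarith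
    have "real n * (1 / \<epsilon>\<^sup>2) * 2 powr 6 = 2 powr (log 2 (real n) + 2 * log 2 (1 / \<epsilon>) + 6)"
      using k by (simp only: powr_add two_powr_log_inverse_square[OF eps]) simp
    also have "\<dots> \<le> 2 powr real d" using d' by simp
    finally have D: "64 * real n \<le> 2 ^ d * \<epsilon>\<^sup>2"
      using eps by (simp add: powr_realpow field_simps)
    have "2 powr real m \<le> 2 powr (real k + real d - 2 * log 2 (1 / \<epsilon>) - 3)"
      using m' by simp
    also have "\<dots> = 2 powr real k * 2 powr real d / (1 / \<epsilon>\<^sup>2) / 2 powr 3"
      by (simp only: powr_diff powr_add two_powr_log_inverse_square[OF eps])
    finally have M: "8 * 2 ^ m \<le> 2 ^ k * (2 ^ d * \<epsilon>\<^sup>2)"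
      using eps by (simp add: powr_realpow field_simps)
    show ?thesis
      using exists_prefix_extractor[OF k(2) _ eps True D M] k by simp
  next
    case False
    \<comment> \<open>For \<open>\<epsilon> > 1\<close> the extractor inequality holds for every
      map, so a constant one serves.\<close>
    have "prefix_extractor n d m k \<epsilon> (\<lambda>_. replicate m False)"
    proof (rule prefix_extractorI)
      show "extractor n d (m - i) (2 ^ (k - i)) \<epsilon> (\<lambda>_. take (m - i) (replicate m False))" for i
        unfolding extractor_def using False
        by (intro graph_extractor_if_card_right_eq_1_or_eps_ge_1) (simp_all, simp add: bitstrings_def)
    qed (use eps in \<open>simp_all add: bitstrings_def\<close>)
    then show ?thesis by blast
  qed
qed

end
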